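(* Let $\mathcal{V}:[0,1]\to\mathcal{D}$ be a vineyard (admitting a decomposition into finitely many vines as described in the context), and denote $P=\mathcal{V}(0)$ and $Q=\mathcal{V}(1)$. Then the unweighted vineyard distance $\mathbb{V}(\mathcal{V})$ satisfies $$W_{\infty,1}(P,Q)\le\mathbb{V}(\mathcal{V}).$$
   Context: Let $\mathbb{R}^2_{x\le y}=\{(x,y)\in\mathbb{R}^2 : x\le y\}$ and let $\Delta=\{(x,x)\}$ be the diagonal. A persistence diagram is a finite multiset of points of $\mathbb{R}^2_{x\le y}$ (points on $\Delta$ are allowed); $\mathcal{D}$ is the set of all persistence diagrams. A partial bijection from a multiset $P$ to a multiset $Q$ is a bijection $\pi:A\to B$ between sub-multisets $A\subseteq P$, $B\subseteq Q$. Write $d_\infty$ for the sup-norm metric on $\mathbb{R}^2$ and $d_\infty(\alpha,\Delta)$ for the distance from $\alpha$ to $\Delta$. The bottleneck distance is $$W_\infty(P,Q)=\min_{\pi:A\to B}\max\Big(\max_{\alpha\in A}d_\infty(\alpha,\pi(\alpha)),\max_{\alpha\in P\setminus A}d_\infty(\alpha,\Delta),\max_{\beta\in Q\setminus B}d_\infty(\beta,\Delta)\Big),$$ and the $(\infty,1)$-Wasserstein distance is $$W_{\infty,1}(P,Q)=\min_{\pi:A\to B}\Big(\sum_{\alpha\in A}d_\infty(\alpha,\pi(\alpha))+\sum_{\alpha\in P\setminus A}d_\infty(\alpha,\Delta)+\sum_{\beta\in Q\setminus B}d_\infty(\beta,\Delta)\Big),$$ both minima being over partial bijections from $P$ to $Q$.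 $\mathcal{D}$ carries the topology arising from $W_\infty$. A vineyard is a continuous map $\mathcal{V}:[0,1]\to\mathcal{D}$. Standing assumption: every vineyard can be decomposed into finitely many rectifiable (continuous) curves $V_i:[0,1]\to\mathbb{R}^2$, $1\le i\le m$, called vines, such that for every $t$, $\mathcal{V}(t)$ is the multiset $\{V_i(t):1\le i\le m\}$, and each vine $V$ in the decomposition is of one of four types: (1) $V$ never meets $\Delta$; (2) $\mathrm{Im}(V)\cap\Delta=\{x\}$ and $V^{-1}(x)$ is a closed interval containing $1$; (3) $\mathrm{Im}(V)\cap\Delta=\{x\}$ and $V^{-1}(x)$ is a closed interval containing $0$; (4) $\mathrm{Im}(V)\cap\Delta=\{x,y\}$ and $V^{-1}(x)\cup V^{-1}(y)$ is a union of two closed intervals which contains $0$ and $1$. The unweighted vineyard distance is $\mathbb{V}(\mathcal{V})=\sum_{i=1}^m\int_{V_i}ds$, the sum of the lengths of the vines in any such decomposition, with length measured in the $\ell^\infty$ metric on the plane. *)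

theory Defs
  imports "HOL-Analysis.Analysis" "HOL-Library.Multiset"
begin

type_synonym point = "real \<times> real"

(* The library metric dist on real \<times> real is Euclidean; infnorm is the sup norm. *)
definition dinf :: "point \<Rightarrow> point \<Rightarrow> real" where
  "dinf p q = infnorm (p - q)"

lemma infnorm_prod: "infnorm (p :: point) = max \<bar>fst p\<bar> \<bar>snd p\<bar>"
proof -
  have "{\<bar>p \<bullet> b\<bar> |b. b \<in> Basis} = {\<bar>fst p\<bar>, \<bar>snd p\<bar>}"
    by (auto simp: Basis_prod_def inner_prod_def)
      (metis Un_iff image_eqI insertI1 inner_prod_def fst_conv snd_conv inner_real_def
        mult.right_neutral mult_zero_right add_0 add.right_neutral)+
  then show ?thesis
    by (simp add: infnorm_def cSup_eq_Max)
qed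

lemma dinf_eq: "dinf p q = max \<bar>fst p - fst q\<bar> \<bar>snd p - snd q\<bar>"
  by (simp add: dinf_def infnorm_prod)

definition diagonal :: "point set" where
  "diagonal = {(x, x) |x. True}"

definition dinf_diagonal :: "point \<Rightarrow> real" where
  "dinf_diagonal p = (INF q\<in>diagonal. dinf p q)"

definition diagrams :: "point multiset set" where
  "diagrams = {P. \<forall>p\<in>#P. fst p \<le> snd p}"

(* A bijection between sub-multisets A of P and B of Q is recorded by the multiset M of its
   matched pairs, so that A = image_mset fst M and B = image_mset snd M. *)
definition partial_bijections :: "'a multiset \<Rightarrow> 'a multiset \<Rightarrow> ('a \<times> 'a) multiset set" where
  "partial_bijections P Q = {M. image_mset fst M \<subseteq># P \<and> image_mset snd M \<subseteq># Q}"

(* The inserted 0 is the maximum over an empty family. *)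
definition bottleneck_cost ::
  "point multiset \<Rightarrow> point multiset \<Rightarrow> (point \<times> point) multiset \<Rightarrow> real" where
  "bottleneck_cost P Q M = Max (insert 0
     ((\<lambda>(p, q). dinf p q) ` set_mset M
      \<union> dinf_diagonal ` set_mset (P - image_mset fst M)
      \<union> dinf_diagonal ` set_mset (Q - image_mset snd M)))"

definition W_inf :: "point multiset \<Rightarrow> point multiset \<Rightarrow> real" where
  "W_inf P Q = Min (bottleneck_cost P Q ` partial_bijections P Q)"

definition wasserstein_cost ::
  "point multiset \<Rightarrow> point multiset \<Rightarrow> (point \<times> point) multiset \<Rightarrow> real" where
  "wasserstein_cost P Q M =
     (\<Sum>(p, q)\<in>#M. dinf p q)
     + (\<Sum>p\<in>#P - image_mset fst M. dinf_diagonal p)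
     + (\<Sum>q\<in>#Q - image_mset snd M. dinf_diagonal q)"

definition W_inf_1 :: "point multiset \<Rightarrow> point multiset \<Rightarrow> real" where
  "W_inf_1 P Q = Min (wasserstein_cost P Q ` partial_bijections P Q)"

(* The next two lemmas ensure that both minima above are genuine. *)
lemma finite_partial_bijections: "finite (partial_bijections P Q)"
proof (rule finite_subset)
  show "partial_bijections P Q
      \<subseteq> (\<Union>n\<le>size P. multisets_of_size (set_mset P \<times> set_mset Q) n)"
  proof
    fix M assume M: "M \<in> partial_bijections P Q"
    then have 1: "image_mset fst M \<subseteq># P" and 2: "image_mset snd M \<subseteq># Q"
      by (auto simp: partial_bijections_def)
    have "size M \<le> size P"
      using size_mset_mono[OF 1] by simp
    moreover have "set_mset M \<subseteq> set_mset P \<times> set_mset Q"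
      using set_mset_mono[OF 1] set_mset_mono[OF 2] by force
    ultimately show "M \<in> (\<Union>n\<le>size P. multisets_of_size (set_mset P \<times> set_mset Q) n)"
      by (auto simp: multisets_of_size_def)
  qed
qed (auto intro!: finite_multisets_of_size)

lemma partial_bijections_nonempty: "partial_bijections P Q \<noteq> {}"
proof -
  have "{#} \<in> partial_bijections P Q"
    by (simp add: partial_bijections_def)
  then show ?thesis by blast
qed

(* W_inf vanishes on some pairs of distinct diagrams, which differ only by diagonal points, so
   the library's metric topologies do not apply; these are the open sets of the pseudometric. *)
definition bottleneck_topology :: "point multiset topology" where
  "bottleneck_topology = topology (\<lambda>U. U \<subseteq> diagrams \<and>
     (\<forall>P\<in>U. \<exists>e>0. \<forall>Q\<in>diagrams. W_inf P Q < e \<longrightarrow> Q \<in> U))"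

lemma openin_bottleneck_topology:
  "openin bottleneck_topology U \<longleftrightarrow> U \<subseteq> diagrams \<and>
     (\<forall>P\<in>U. \<exists>e>0. \<forall>Q\<in>diagrams. W_inf P Q < e \<longrightarrow> Q \<in> U)"
proof -
  have "istopology (\<lambda>U. U \<subseteq> diagrams \<and>
     (\<forall>P\<in>U. \<exists>e>0. \<forall>Q\<in>diagrams. W_inf P Q < e \<longrightarrow> Q \<in> U))" (is "istopology ?O")
    unfolding istopology_def
  proof (intro conjI allI impI)
    fix S T assume S: "?O S" and T: "?O T"
    show "S \<inter> T \<subseteq> diagrams" using S by blast
    show "\<forall>P\<in>S \<inter> T. \<exists>e>0. \<forall>Q\<in>diagrams. W_inf P Q < e \<longrightarrow> Q \<in> S \<inter> T"
    proof
      fix P assume "P \<in> S \<inter> T"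
      then obtain d e where "d > 0" "\<forall>Q\<in>diagrams. W_inf P Q < d \<longrightarrow> Q \<in> S"
        and "e > 0" "\<forall>Q\<in>diagrams. W_inf P Q < e \<longrightarrow> Q \<in> T"
        using S T by blast
      then show "\<exists>e>0. \<forall>Q\<in>diagrams. W_inf P Q < e \<longrightarrow> Q \<in> S \<inter> T"
        by (intro exI[of _ "min d e"]) auto
    qed
  next
    fix K assume K: "\<forall>S\<in>K. ?O S"
    show "\<Union>K \<subseteq> diagrams" using K by blast
    show "\<forall>P\<in>\<Union>K. \<exists>e>0. \<forall>Q\<in>diagrams. W_inf P Q < e \<longrightarrow> Q \<in> \<Union>K"
      using K by (meson UnionE UnionI)
  qed
  then show ?thesis
    unfolding bottleneck_topology_def by (simp add: topology_inverse')
qed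

lemma topspace_bottleneck_topology: "topspace bottleneck_topology = diagrams"
proof -
  have "openin bottleneck_topology diagrams"
    by (auto simp: openin_bottleneck_topology intro: exI[of _ 1])
  then show ?thesis
    by (meson openin_bottleneck_topology openin_subset openin_topspace subset_antisym)
qed

(* Only the values on the unit interval matter. *)
definition vineyard :: "(real \<Rightarrow> point multiset) \<Rightarrow> bool" where
  "vineyard \<V> \<longleftrightarrow> continuous_map (top_of_set {0..1}) bottleneck_topology \<V>"

definition chord_sums :: "(real \<Rightarrow> point) \<Rightarrow> real set" where
  "chord_sums V = {\<Sum>k<n. dinf (V (t k)) (V (t (Suc k))) |n t.
     t 0 = 0 \<and> t n = 1 \<and> (\<forall>k<n. t k \<le> t (Suc k))}"

(* All norms on the plane give the same rectifiable curves. *)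
definition rectifiable :: "(real \<Rightarrow> point) \<Rightarrow> bool" where
  "rectifiable V \<longleftrightarrow> bdd_above (chord_sums V)"

definition curve_length :: "(real \<Rightarrow> point) \<Rightarrow> real" where
  "curve_length V = Sup (chord_sums V)"

definition preim :: "(real \<Rightarrow> point) \<Rightarrow> point \<Rightarrow> real set" where
  "preim V x = {t \<in> {0..1}. V t = x}"

definition closed_interval :: "real set \<Rightarrow> bool" where
  "closed_interval I \<longleftrightarrow> (\<exists>a b. a \<le> b \<and> I = {a..b})"

definition vine_type1 :: "(real \<Rightarrow> point) \<Rightarrow> bool" where
  "vine_type1 V \<longleftrightarrow> path_image V \<inter> diagonal = {}"

definition vine_type2 :: "(real \<Rightarrow> point) \<Rightarrow> bool" where
  "vine_type2 V \<longleftrightarrow> (\<exists>x. path_image V \<inter> diagonal = {x} \<and>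
     closed_interval (preim V x) \<and> 1 \<in> preim V x)"

definition vine_type3 :: "(real \<Rightarrow> point) \<Rightarrow> bool" where
  "vine_type3 V \<longleftrightarrow> (\<exists>x. path_image V \<inter> diagonal = {x} \<and>
     closed_interval (preim V x) \<and> 0 \<in> preim V x)"

(* x and y are allowed to coincide. *)
definition vine_type4 :: "(real \<Rightarrow> point) \<Rightarrow> bool" where
  "vine_type4 V \<longleftrightarrow> (\<exists>x y. path_image V \<inter> diagonal = {x, y} \<and>
     (\<exists>I J. closed_interval I \<and> closed_interval J \<and> preim V x \<union> preim V y = I \<union> J) \<and>
     0 \<in> preim V x \<union> preim V y \<and> 1 \<in> preim V x \<union> preim V y)"

definition vine :: "(real \<Rightarrow> point) \<Rightarrow> bool" where
  "vine V \<longleftrightarrow> path V \<and> rectifiable V \<and>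
     (vine_type1 V \<or> vine_type2 V \<or> vine_type3 V \<or> vine_type4 V)"

definition vine_decomposition ::
  "(real \<Rightarrow> point multiset) \<Rightarrow> nat \<Rightarrow> (nat \<Rightarrow> real \<Rightarrow> point) \<Rightarrow> bool" where
  "vine_decomposition \<V> m V \<longleftrightarrow> (\<forall>i\<in>{1..m}. vine (V i)) \<and>
     (\<forall>t\<in>{0..1}. \<V> t = {# V i t. i \<in># mset_set {1..m} #})"

(* The unweighted vineyard distance of a vineyard is the value of this sum on any of its vine
   decompositions; statements about it quantify over all of them. *)
definition vineyard_distance :: "nat \<Rightarrow> (nat \<Rightarrow> real \<Rightarrow> point) \<Rightarrow> real" where
  "vineyard_distance m V = (\<Sum>i=1..m. curve_length (V i))"

end

theory Submission
  imports Defs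
begin

text \<open>Following each vine from time 0 to time 1 matches all of \<open>\<V> 0\<close> with all
  of \<open>\<V> 1\<close>. \<open>W_inf_1\<close> is a minimum over matchings, so it is at most the
  cost of this one, the sum of the endpoint distances of the vines
  (\<open>W_inf_1_le_sum_dinf\<close>). No curve is shorter than the chord between its endpoints
  (\<open>dinf_endpoints_le_curve_length\<close>).\<close>

lemma dinf_endpoints_le_curve_length:
  assumes "rectifiable V"
  shows "dinf (V 0) (V 1) \<le> curve_length V"
proof -
  have "dinf (V 0) (V 1) \<in> chord_sums V"
    unfolding chord_sums_def
    \<comment> \<open>The partition with the single step from 0 to 1: \<open>real\<close> sends the
      indices 0 and 1 to these times.\<close>
    by (intro CollectI exI[of _ "1::nat"] exI[of _ real]) simp
  then show ?thesis
    using assms unfolding curve_length_def rectifiable_def by (rule cSup_upper)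
qed

text \<open>Pairing entries by their common index is a partial bijection that leaves nothing
  unmatched, even when values repeat.\<close>

lemma W_inf_1_le_sum_dinf:
  assumes "finite I"
  shows "W_inf_1 {# p i. i \<in># mset_set I #} {# q i. i \<in># mset_set I #} \<le> (\<Sum>i\<in>I. dinf (p i) (q i))"
    (is "W_inf_1 ?P ?Q \<le> _")
proof -
  define M where "M = {# (p i, q i). i \<in># mset_set I #}"
  have fst: "image_mset fst M = ?P" and snd: "image_mset snd M = ?Q"
    by (simp_all add: M_def multiset.map_comp o_def)
  have "M \<in> partial_bijections ?P ?Q"
    by (simp add: partial_bijections_def fst snd)
  then have "W_inf_1 ?P ?Q \<le> wasserstein_cost ?P ?Q M"
    unfolding W_inf_1_def by (intro Min_le finite_imageI finite_partial_bijections imageI)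
  \<comment> \<open>Both projections of \<open>M\<close> exhaust the diagrams, so the two diagonal
    sums are empty.\<close>
  also have "\<dots> = (\<Sum>i\<in>I. dinf (p i) (q i))"
    unfolding wasserstein_cost_def fst snd
    by (simp add: M_def multiset.map_comp o_def sum_unfold_sum_mset)
  finally show ?thesis .
qed

theorem theorem4:
  fixes \<V> :: "real \<Rightarrow> point multiset" and m :: nat and V :: "nat \<Rightarrow> real \<Rightarrow> point"
  assumes "vineyard \<V>"
    and "vine_decomposition \<V> m V"
  shows "W_inf_1 (\<V> 0) (\<V> 1) \<le> vineyard_distance m V"
proof -
  have ends: "\<V> 0 = {# V i 0. i \<in># mset_set {1..m} #}" "\<V> 1 = {# V i 1. i \<in># mset_set {1..m} #}"
    and rect: "\<And>i. i \<in> {1..m} \<Longrightarrow> rectifiable (V i)"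
    using assms(2) by (auto simp: vine_decomposition_def vine_def)
  have "W_inf_1 (\<V> 0) (\<V> 1) \<le> (\<Sum>i=1..m. dinf (V i 0) (V i 1))"
    unfolding ends by (rule W_inf_1_le_sum_dinf) simp
  also have "\<dots> \<le> vineyard_distance m V"
    unfolding vineyard_distance_def
    by (intro sum_mono dinf_endpoints_le_curve_length rect)
  finally show ?thesis .
qed

end
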